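(* Let $\{r_j \pmod{m_j} : 1\le j\le \tau\}$ be a covering system of the integers, and for each $1\le j\le\tau$ let $p_j$ be a prime divisor of $2^{m_j}-1$. Then there is no positive integer $t$ such that the $2$-repdigit $k=2^t-1$ satisfies $k\equiv -2^{-r_j}\pmod{p_j}$ for every $1\le j\le\tau$. In other words, the covering system method cannot yield a $2$-repdigit Sierpiński number.
   Context: A covering system of the integers is a finite collection of congruences $r_j \pmod{m_j}$ (with positive integer moduli $m_j$) such that every integer satisfies at least one of them. For a prime $p$ not dividing $2$, $2^{-r}\pmod p$ denotes the inverse of $2^r$ modulo $p$. For integers $b\ge 2$, $1\le k<b$, $t\ge1$, the $b$-repdigit $k_b^{(t)}$ is $k(b^t-1)/(b-1)$ (the digit $k$ repeated $t$ times in base $b$); so the $2$-repdigits are exactly the numbers $2^t-1$. A Sierpiński number is an odd positive integer $k$ such that $k\cdot 2^n+1$ is composite for all positive integers $n$. The covering system method produces a Sierpiński number $k$ from a covering system $\{r_j\pmod{m_j}\}$ and distinct primes $p_j\mid 2^{m_j}-1$ by requiring $k$ odd, $k\equiv -2^{-r_j}\pmod{p_j}$ for all $j$, and $k$ sufficiently large. *)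

theory Defs
  imports "HOL-Number_Theory.Number_Theory"
begin

definition covering_system :: "nat \<Rightarrow> (nat \<Rightarrow> int) \<Rightarrow> (nat \<Rightarrow> nat) \<Rightarrow> bool" where
  "covering_system \<tau> r m \<longleftrightarrow>
     (\<forall>j\<in>{1..\<tau>}. m j > 0) \<and>
     (\<forall>n::int. \<exists>j\<in>{1..\<tau>}. [n = r j] (mod int (m j)))"

text \<open>
  The residue of $2^{-r}$ modulo $p$, for $p$ odd. Since the representatives $r_j$ of a covering
  system are arbitrary integers, negative $r$ is allowed; then $2^{-r}$ is an ordinary power.
\<close>
definition two_neg_power :: "nat \<Rightarrow> int \<Rightarrow> int" where
  "two_neg_power p r =
     (if r \<ge> 0 then modular_inverse (int p) (2 ^ nat r) else 2 ^ nat (- r) mod int p)"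

text \<open>The division is exact.\<close>
definition repdigit :: "nat \<Rightarrow> nat \<Rightarrow> nat \<Rightarrow> nat" where
  "repdigit b d t = d * (b ^ t - 1) div (b - 1)"

definition is_repdigit :: "nat \<Rightarrow> nat \<Rightarrow> bool" where
  "is_repdigit b k \<longleftrightarrow> (\<exists>d t. 1 \<le> d \<and> d < b \<and> t \<ge> 1 \<and> k = repdigit b d t)"

definition composite :: "nat \<Rightarrow> bool" where
  "composite n \<longleftrightarrow> n > 1 \<and> \<not> prime n"

definition sierpinski_number :: "nat \<Rightarrow> bool" where
  "sierpinski_number k \<longleftrightarrow> odd k \<and> k > 0 \<and> (\<forall>n>0. composite (k * 2 ^ n + 1))"

definition covering_congruences ::
    "nat \<Rightarrow> (nat \<Rightarrow> int) \<Rightarrow> (nat \<Rightarrow> nat) \<Rightarrow> nat \<Rightarrow> bool" where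
  "covering_congruences \<tau> r p k \<longleftrightarrow>
     (\<forall>j\<in>{1..\<tau>}. [int k = - two_neg_power (p j) (r j)] (mod int (p j)))"

text \<open>
  The informal requirement that $k$ be sufficiently large only serves to make $k$ a Sierpinski
  number, by excluding the possibility that $k 2^n + 1$ equals one of the $p_j$. It is therefore
  rendered by its purpose: $k$ is required to be a Sierpinski number, with no explicit size bound.
\<close>
definition covering_method_yields ::
    "nat \<Rightarrow> (nat \<Rightarrow> int) \<Rightarrow> (nat \<Rightarrow> nat) \<Rightarrow> (nat \<Rightarrow> nat) \<Rightarrow> nat \<Rightarrow> bool" where
  "covering_method_yields \<tau> r m p k \<longleftrightarrow>
     covering_system \<tau> r m \<and>
     (\<forall>j\<in>{1..\<tau>}. prime (p j) \<and> p j dvd 2 ^ m j - 1) \<and>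
     inj_on p {1..\<tau>} \<and>
     odd k \<and> covering_congruences \<tau> r p k \<and> sierpinski_number k"

end

(* The congruence class containing n = 0 already gives the contradiction: there 2^(-r) = 1 modulo p,
   so 2^t - 1 = -1 and p divides 2^t, although p divides the odd number 2^m - 1. *)

theory Submission
  imports Defs
begin

text \<open>Only a class containing 0 matters. There m_j divides r_j, and since 2^(m_j) = 1 modulo
  p_j, also 2^(-r_j) = 1 (\<open>two_neg_power_cong_1\<close>). The required congruence becomes 2^t
  - 1 = -1, so p_j divides 2^t and equals 2, yet p_j divides the odd number 2^(m_j) - 1
  (\<open>not_covering_congruences_two_power_minus_1\<close>).\<close>

lemma two_power_cong_1:
  fixes p m n :: nat
  assumes "p dvd 2 ^ m - 1" and "m dvd n"
  shows "[2 ^ n = 1] (mod int p)"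
proof -
  have "int p dvd int (2 ^ m - 1)"
    using assms(1) by (simp only: int_dvd_int_iff)
  hence m: "[2 ^ m = 1] (mod int p)"
    by (simp add: cong_iff_dvd_diff of_nat_diff)
  from assms(2) obtain k where "n = m * k" by (elim dvdE)
  with cong_pow[OF m, of k] show ?thesis by (simp add: power_mult)
qed

lemma two_neg_power_cong_1:
  assumes "p dvd 2 ^ m - 1" and "int m dvd r"
  shows "[two_neg_power p r = 1] (mod int p)"
proof (cases "r \<ge> 0")
  case True
  have "m dvd nat r"
    using assms(2) True by (simp add: nat_dvd_iff flip: int_dvd_int_iff)
  with assms(1) have one: "[2 ^ nat r = 1] (mod int p)" by (rule two_power_cong_1)
  \<comment> \<open>A number congruent to 1 is a unit, so the modular inverse is a genuine
    one.\<close>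
  hence "coprime (2 ^ nat r) (int p)"
    using cong_imp_coprime[OF cong_sym[OF one]] by simp
  hence "[2 ^ nat r * modular_inverse (int p) (2 ^ nat r) = 1] (mod int p)"
    by (rule cong_modular_inverse1)
  \<comment> \<open>Replacing the factor 2^r by 1 leaves the inverse alone, so it is itself
    congruent to 1.\<close>
  moreover have "[2 ^ nat r * modular_inverse (int p) (2 ^ nat r)
      = 1 * modular_inverse (int p) (2 ^ nat r)] (mod int p)"
    using one by (rule cong_mult) simp
  ultimately show ?thesis
    using True by (simp add: two_neg_power_def cong_def)
next
  case False
  have "m dvd nat (- r)"
    using assms(2) False by (simp flip: int_dvd_int_iff)
  with assms(1) have "[2 ^ nat (- r) = 1] (mod int p)" by (rule two_power_cong_1)
  thus ?thesis using False by (simp add: two_neg_power_def cong_def)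
qed

lemma not_covering_congruences_two_power_minus_1:
  assumes cover: "covering_system \<tau> r m"
    and prime: "\<And>j. j \<in> {1..\<tau>} \<Longrightarrow> prime (p j)"
    and dvd: "\<And>j. j \<in> {1..\<tau>} \<Longrightarrow> p j dvd 2 ^ m j - 1"
  shows "\<not> covering_congruences \<tau> r p (2 ^ t - 1)"
proof
  assume congs: "covering_congruences \<tau> r p (2 ^ t - 1)"
  \<comment> \<open>Covering 0 selects an index whose residue r_j is a multiple of m_j.\<close>
  from cover obtain j where j: "j \<in> {1..\<tau>}" "[0 = r j] (mod int (m j))" and m: "m j > 0"
    unfolding covering_system_def by blast
  have "int (m j) dvd r j"
    using j(2) by (simp add: cong_sym_eq[of 0] cong_0_iff)
  with dvd[OF j(1)] have "[two_neg_power (p j) (r j) = 1] (mod int (p j))"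
    by (rule two_neg_power_cong_1)
  moreover have "[int (2 ^ t - 1) = - two_neg_power (p j) (r j)] (mod int (p j))"
    using congs j(1) unfolding covering_congruences_def by blast
  ultimately have "[int (2 ^ t - 1) = - 1] (mod int (p j))"
    by (meson cong_minus_minus_iff cong_trans)
  hence "int (p j) dvd int (2 ^ t)"
    by (simp add: cong_iff_dvd_diff of_nat_diff)
  hence "p j dvd 2 ^ t" by (simp only: int_dvd_int_iff)
  hence "p j dvd 2"
    using prime[OF j(1)] by (rule prime_dvd_power[rotated])
  hence "p j = 2"
    using prime[OF j(1)] by (simp add: primes_dvd_imp_eq)
  \<comment> \<open>Positivity of m_j matters: it makes 2^(m_j) - 1 odd, whereas exponent 0 would
    give 0, which 2 divides.\<close>
  with dvd[OF j(1)] m show False by simp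
qed

theorem theorem3p2:
  fixes \<tau> :: nat and r :: "nat \<Rightarrow> int" and m p :: "nat \<Rightarrow> nat"
  assumes "covering_system \<tau> r m"
    and "\<And>j. j \<in> {1..\<tau>} \<Longrightarrow> prime (p j)"
    and "\<And>j. j \<in> {1..\<tau>} \<Longrightarrow> p j dvd 2 ^ m j - 1"
  shows "\<not> (\<exists>t::nat. t > 0 \<and> covering_congruences \<tau> r p (2 ^ t - 1)) \<and>
         \<not> (\<exists>k. is_repdigit 2 k \<and> covering_method_yields \<tau> r m p k)"
proof -
  have no: "\<not> covering_congruences \<tau> r p (2 ^ t - 1)" for t
    using assms by (rule not_covering_congruences_two_power_minus_1)
  have "\<exists>t. k = 2 ^ t - 1" if "is_repdigit 2 k" for k
  proof -
    from that obtain d t where "1 \<le> d" "d < 2" "k = repdigit 2 d t"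
      unfolding is_repdigit_def by blast
    \<comment> \<open>Base 2 allows only the digit 1, and the denominator b - 1 is 1, which leaves
      2^t - 1.\<close>
    moreover from this have "d = 1" by simp
    ultimately show ?thesis by (auto simp: repdigit_def)
  qed
  with no show ?thesis unfolding covering_method_yields_def by blast
qed

end
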